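(* Let $p,q$ be integers with $1\le p<q-p$, and let $u=0^{q-p}1^p$. Then for every binary word $w\in\{0,1\}^q$ with exactly $p$ ones, $$\mathcal{P}_i(u)\le\mathcal{P}_i(w)\quad\text{for all }1\le i\le q.$$ In other words, the orbit of $u$ is the greatest element of the set $\mathbb{W}_{p,q}$ of orbits with respect to the order $\prec_p$.
   Context: Binary alphabet $\{0,1\}$ with $0<1$; words of equal length are compared lexicographically. For a word $x=x_1\cdots x_n$, $(x)_2=\sum_{i=1}^n x_i2^{n-i}$. The cyclic shift is $\sigma(w_1\cdots w_n)=w_2\cdots w_nw_1$. For $w\in\{0,1\}^q$, $\mathcal{O}_1(w)\le\dots\le\mathcal{O}_q(w)$ are the $q$ words $w,\sigma(w),\dots,\sigma^{q-1}(w)$ sorted lexicographically (with repetition), and $\mathcal{I}_k(w)=(\mathcal{O}_k(w))_2$. Partial products: $\mathcal{P}_i(w)=\prod_{k=1}^i\mathcal{I}_k(w)$. $\mathbb{W}_{p,q}$ is the set of orbits (words up to cyclic shift) of binary words of length $q$ with $p$ ones; for orbits $w,w'$, $w'\prec_p w$ means $\mathcal{P}_i(w')\ge\mathcal{P}_i(w)$ for all $1\le i\le q$. *)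

theory Defs
  imports Main "HOL-Library.List_Lexorder"
begin

text \<open>Binary words are lists of booleans, with False = 0 < True = 1.
  Lists are ordered lexicographically (List_Lexorder); on words of equal length
  this is the usual lexicographic order.\<close>

definition bin_val :: "bool list \<Rightarrow> nat" where
  "bin_val x = (\<Sum>i<length x. (if x ! i then 2 ^ (length x - Suc i) else 0))"

definition orbit_sorted :: "bool list \<Rightarrow> bool list list" where
  "orbit_sorted w = sort (map (\<lambda>k. rotate k w) [0..<length w])"

definition I_val :: "bool list \<Rightarrow> nat \<Rightarrow> nat" where
  "I_val w k = bin_val (orbit_sorted w ! (k - 1))"

definition P_val :: "bool list \<Rightarrow> nat \<Rightarrow> nat" where
  "P_val w i = (\<Prod>k=1..i. I_val w k)"

definition ones :: "bool list \<Rightarrow> nat" where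
  "ones w = length (filter id w)"

end

(* By the logarithm it suffices that the partial sums of the sorted rotation values of u are
   dominated by those of w. Up to complementation only rotations starting with 0 matter. If A is
   a set of i positions of zeros and C the set of all p ones, a one at c contributes to the
   rotation starting at a a power of two whose exponent is at least the number of elements of
   A and C strictly between c and a on the cycle. The sum of these powers is at least
   (2^i - 1) (2^p - 1), by induction on i: removing a zero a0 halves the terms of all pairs
   (c, a) with a0 between c and a. The first i values of u attain this bound. *)

theory Submission
  imports Defs Complex_Main "HOL-Library.Multiset"
begin

section \<open>Counting between points of a cycle\<close>

text \<open>The open arc is oriented from a one \<open>c\<close> upwards to a start
  \<open>a\<close>, since the rotation starting at \<open>a\<close> ends just before
  \<open>a\<close> and a one there has exponent 0. No length of the cycle enters, so the counting
  below depends only on the order of the points.\<close>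

definition cyc_between :: "nat \<Rightarrow> nat \<Rightarrow> nat \<Rightarrow> bool" where
  "cyc_between c a m \<longleftrightarrow> (if c < a then c < m \<and> m < a else m < a \<or> c < m)"

definition cyc_count :: "nat set \<Rightarrow> nat \<Rightarrow> nat \<Rightarrow> nat" where
  "cyc_count M c a = card {m \<in> M. cyc_between c a m}"

lemma cyc_count_mono: "finite N \<Longrightarrow> M \<subseteq> N \<Longrightarrow> cyc_count M c a \<le> cyc_count N c a"
  unfolding cyc_count_def by (rule card_mono) auto

lemma cyc_count_Un:
  assumes "finite M" "finite N" "M \<inter> N = {}"
  shows "cyc_count (M \<union> N) c a = cyc_count M c a + cyc_count N c a"
proof -
  have "{m \<in> M \<union> N. cyc_between c a m} = {m \<in> M. cyc_between c a m} \<union> {m \<in> N. cyc_between c a m}"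
    by auto
  then show ?thesis
    unfolding cyc_count_def using assms by (simp add: card_Un_disjoint disjoint_iff)
qed

text \<open>The exponents are the ranks 0, ..., \<open>card B - 1\<close>, so this is a geometric
  sum; the \<open>+ 1\<close> on the left avoids truncated subtraction.\<close>

lemma sum_power2_card_less:
  fixes B :: "'a::linorder set"
  assumes "finite B"
  shows "(\<Sum>b\<in>B. 2 ^ card {x\<in>B. x < b}) + 1 = (2 ^ card B :: nat)"
  using assms
proof (induction B rule: finite_linorder_max_induct)
  case (insert b B)
  have "{x \<in> insert b B. x < b} = B" using insert by auto
  moreover have "{x \<in> insert b B. x < y} = {x \<in> B. x < y}" if "y \<in> B" for y
    using insert that by force
  moreover have "b \<notin> B" using insert by auto
  ultimately show ?case using insert by simp
qed auto

lemma sum_power2_card_greater: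
  fixes B :: "'a::linorder set"
  assumes "finite B"
  shows "(\<Sum>b\<in>B. 2 ^ card {x\<in>B. b < x}) + 1 = (2 ^ card B :: nat)"
  using assms
proof (induction B rule: finite_linorder_min_induct)
  case (insert b B)
  have "{x \<in> insert b B. b < x} = B" using insert by auto
  moreover have "{x \<in> insert b B. y < x} = {x \<in> B. y < x}" if "y \<in> B" for y
    using insert that by force
  moreover have "b \<notin> B" using insert by auto
  ultimately show ?case using insert by simp
qed auto

text \<open>Walking backwards from \<open>a\<close> around the cycle, the elements of
  \<open>C\<close> are met one after another, so their counts are 0, ..., \<open>card C - 1\<close>:
  first those below \<open>a\<close>, then, after wrapping, those above it.\<close>

lemma sum_power2_cyc_count:
  assumes fin: "finite C" and a: "a \<notin> C"
  shows "(\<Sum>c\<in>C. 2 ^ cyc_count C c a) + 1 = (2 ^ card C :: nat)"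
proof -
  define L where "L = {c\<in>C. c < a}"
  define G where "G = {c\<in>C. a < c}"
  have C: "C = L \<union> G" and disj: "L \<inter> G = {}" and fLG: "finite L" "finite G"
    using a fin by (auto simp: L_def G_def intro: linorder_neqE_nat)
  have cL: "cyc_count C c a = card {x\<in>L. c < x}" if "c \<in> L" for c
    using that unfolding cyc_count_def cyc_between_def
    by (intro arg_cong[where f = card]) (auto simp: L_def)
  have cG: "cyc_count C c a = card L + card {x\<in>G. c < x}" if "c \<in> G" for c
  proof -
    have "{m \<in> C. cyc_between c a m} = L \<union> {x\<in>G. c < x}"
      using that by (auto simp: L_def G_def cyc_between_def)
    then show ?thesis
      unfolding cyc_count_def using fLG disj by (subst card_Un_disjoint[symmetric]) auto
  qed
  have "(\<Sum>c\<in>C. 2 ^ cyc_count C c a :: nat) =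
      (\<Sum>c\<in>L. 2 ^ card {x\<in>L. c < x}) + 2 ^ card L * (\<Sum>c\<in>G. 2 ^ card {x\<in>G. c < x})"
    unfolding sum.union_disjoint[OF fLG disj, folded C] sum_distrib_left
    using cL cG by (simp add: power_add)
  moreover have "2 ^ card C = (2 ^ card L * 2 ^ card G :: nat)"
    using C fLG disj by (simp add: card_Un_disjoint power_add)
  ultimately show ?thesis
    using sum_power2_card_greater[OF fLG(1)] 
    by (simp flip: sum_power2_card_greater[OF fLG(2)])
qed

text \<open>The inductive step for a single one \<open>c\<close>: the new zero \<open>a0\<close>
  brings its own term and doubles the term of each zero whose arc from \<open>c\<close> passes over
  \<open>a0\<close>. Summed over \<open>c\<close>, this gain is exactly what the product bound
  requires.\<close>

lemma cyc_count_insert_max_gain: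
  assumes fin: "finite A" "finite C" and disj: "A \<inter> C = {}"
    and c: "c \<in> C" and a0: "a0 \<notin> C" and max: "\<And>a. a \<in> A \<Longrightarrow> a < a0"
  shows "(\<Sum>a\<in>A. 2 ^ cyc_count (A \<union> C) c a) + 2 ^ (card A + cyc_count C c a0)
      \<le> (\<Sum>a\<in>insert a0 A. 2 ^ cyc_count (insert a0 A \<union> C) c a :: nat)"
proof -
  let ?M = "A \<union> C" and ?N = "insert a0 A \<union> C"
  have fM: "finite ?M" "finite ?N" using fin by auto
  have notin: "a0 \<notin> A" using max by blast
  have mono: "cyc_count ?M c a \<le> cyc_count ?N c a" for a
    using fM by (intro cyc_count_mono) auto
  have split: "cyc_count ?M c a = cyc_count A c a + cyc_count C c a" for a
    using fin disj by (rule cyc_count_Un)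
  have sumN: "(\<Sum>a\<in>insert a0 A. 2 ^ cyc_count ?N c a :: nat) =
      2 ^ cyc_count ?N c a0 + (\<Sum>a\<in>A. 2 ^ cyc_count ?N c a)"
    using fin notin by simp
  show ?thesis
  proof (cases "a0 < c")
    case True
    \<comment> \<open>Here the arc from \<open>c\<close> wraps and reaches \<open>a0\<close> last,
      past all of \<open>A\<close>, so the new term alone yields the gain.\<close>
    have "cyc_count A c a0 = card A"
      unfolding cyc_count_def cyc_between_def using True max
      by (intro arg_cong[where f = card]) auto
    then have "card A + cyc_count C c a0 \<le> cyc_count ?N c a0"
      using mono[of a0] split[of a0] by simp
    then show ?thesis
      unfolding sumN by (subst add.commute, intro add_mono sum_mono power_increasing mono) auto
  next
    case False
    then have less: "c < a0" using c a0 by (cases "c = a0") auto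
    \<comment> \<open>\<open>B\<close> holds the zeros whose arc from \<open>c\<close> wraps around
      and hence contains \<open>a0\<close>; \<open>k\<close> bounds the exponent of the new term
      from below.\<close>
    define B where "B = {a\<in>A. a < c}"
    define k where "k = cyc_count C c a0 + card {a\<in>A. c < a}"
    have fB: "finite B" "B \<subseteq> A" using fin by (auto simp: B_def)
    have cardA: "card A = card B + card {a\<in>A. c < a}"
    proof -
      have "A = B \<union> {a\<in>A. c < a}" using c disj by (auto simp: B_def intro: linorder_neqE_nat)
      moreover have "B \<inter> {a\<in>A. c < a} = {}" by (auto simp: B_def)
      ultimately show ?thesis using fin by (metis card_Un_disjoint finite_Un)
    qed
    have "cyc_count A c a0 = card {a\<in>A. c < a}"
      unfolding cyc_count_def cyc_between_def using less max
      by (intro arg_cong[where f = card]) auto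
    then have a0_term: "k \<le> cyc_count ?N c a0"
      using mono[of a0] split[of a0] by (simp add: k_def)
    have double: "cyc_count ?N c a = Suc (cyc_count ?M c a)" if "a \<in> B" for a
    proof -
      have "{m \<in> ?N. cyc_between c a m} = insert a0 {m \<in> ?M. cyc_between c a m}"
        using that less by (auto simp: B_def cyc_between_def)
      then show ?thesis
        unfolding cyc_count_def using fM notin a0 by simp
    qed
    \<comment> \<open>The wrapping arc from \<open>c\<close> to \<open>a\<close> covers everything
      above \<open>c\<close>, in particular what lies between \<open>c\<close> and
      \<open>a0\<close>, and then the elements of \<open>B\<close> below \<open>a\<close>.\<close>
    have low: "k + card {x\<in>B. x < a} \<le> cyc_count ?M c a" if "a \<in> B" for a
    proof -
      have "cyc_count C c a0 \<le> cyc_count C c a"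
        unfolding cyc_count_def cyc_between_def using that less fin
        by (intro card_mono) (auto simp: B_def)
      moreover have "card {a\<in>A. c < a} + card {x\<in>B. x < a} \<le> cyc_count A c a"
      proof -
        have "card {a\<in>A. c < a} + card {x\<in>B. x < a} = card ({a\<in>A. c < a} \<union> {x\<in>B. x < a})"
          using fin by (intro card_Un_disjoint[symmetric]) (auto simp: B_def)
        also have "\<dots> \<le> cyc_count A c a"
          unfolding cyc_count_def cyc_between_def using that fin
          by (intro card_mono) (auto simp: B_def)
        finally show ?thesis .
      qed
      ultimately show ?thesis using split[of a] by (simp add: k_def)
    qed
    have "(\<Sum>a\<in>B. 2 ^ cyc_count ?N c a) = 2 * (\<Sum>a\<in>B. 2 ^ cyc_count ?M c a :: nat)"
      unfolding sum_distrib_left by (rule sum.cong) (simp_all only: double power_Suc)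
    then have "(\<Sum>a\<in>A. 2 ^ cyc_count ?M c a) + (\<Sum>a\<in>B. 2 ^ cyc_count ?M c a)
        = (\<Sum>a\<in>A - B. 2 ^ cyc_count ?M c a) + (\<Sum>a\<in>B. 2 ^ cyc_count ?N c a :: nat)"
      using sum.subset_diff[OF fB(2) fin(1), of "\<lambda>a. 2 ^ cyc_count ?M c a :: nat"]
      by simp
    also have "\<dots> \<le> (\<Sum>a\<in>A - B. 2 ^ cyc_count ?N c a) + (\<Sum>a\<in>B. 2 ^ cyc_count ?N c a)"
      by (intro add_mono sum_mono power_increasing mono) auto
    also have "\<dots> = (\<Sum>a\<in>A. 2 ^ cyc_count ?N c a)"
      using sum.subset_diff[OF fB(2) fin(1)] by metis
    finally have gain: "(\<Sum>a\<in>A. 2 ^ cyc_count ?M c a) + (\<Sum>a\<in>B. 2 ^ cyc_count ?M c a)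
        \<le> (\<Sum>a\<in>A. 2 ^ cyc_count ?N c a :: nat)" .
    \<comment> \<open>The new term gives at least \<open>2 ^ k\<close>, the doubling at least
      \<open>2 ^ k * (2 ^ card B - 1)\<close>; together they make up the required power.\<close>
    have "2 ^ (card A + cyc_count C c a0) = (2 ^ k * 2 ^ card B :: nat)"
      by (simp add: cardA k_def power_add)
    also have "\<dots> = 2 ^ k + (\<Sum>a\<in>B. 2 ^ (k + card {x\<in>B. x < a}))"
      by (simp add: power_add sum_distrib_left flip: sum_power2_card_less[OF fB(1)])
    also have "\<dots> \<le> 2 ^ cyc_count ?N c a0 + (\<Sum>a\<in>B. 2 ^ cyc_count ?M c a)"
      by (intro add_mono sum_mono power_increasing low a0_term) auto
    finally show ?thesis unfolding sumN using gain by linarith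
  qed
qed

lemma sum_power2_cyc_count_ge:
  assumes "finite A" "finite C" "A \<inter> C = {}"
  shows "(2 ^ card A - 1) * (2 ^ card C - 1)
      \<le> (\<Sum>a\<in>A. \<Sum>c\<in>C. 2 ^ cyc_count (A \<union> C) c a :: nat)"
  using assms
proof (induction A rule: finite_linorder_max_induct)
  case (insert a0 A)
  have a0: "a0 \<notin> A" "a0 \<notin> C" using insert by auto
  have "2 ^ card A * (2 ^ card C - 1) = (2 ^ card A * (\<Sum>c\<in>C. 2 ^ cyc_count C c a0) :: nat)"
    using sum_power2_cyc_count[of C a0] a0 insert by (metis add_diff_cancel_right')
  then have gain: "2 ^ card A * (2 ^ card C - 1) = (\<Sum>c\<in>C. 2 ^ (card A + cyc_count C c a0) :: nat)"
    by (simp add: power_add sum_distrib_left)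
  have "(2 ^ card (insert a0 A) - 1) * (2 ^ card C - 1) =
      (2 ^ card A - 1) * (2 ^ card C - 1) + 2 ^ card A * (2 ^ card C - 1 :: nat)"
    using a0 insert by (simp add: mult_2 flip: add_mult_distrib)
  also have "\<dots> \<le> (\<Sum>a\<in>A. \<Sum>c\<in>C. 2 ^ cyc_count (A \<union> C) c a)
        + (\<Sum>c\<in>C. 2 ^ (card A + cyc_count C c a0) :: nat)"
    unfolding gain using insert.IH insert.prems by (intro add_mono) auto
  also have "\<dots> = (\<Sum>c\<in>C. (\<Sum>a\<in>A. 2 ^ cyc_count (A \<union> C) c a) + 2 ^ (card A + cyc_count C c a0))"
    by (subst sum.swap) (simp add: sum.distrib)
  also have "\<dots> \<le> (\<Sum>c\<in>C. \<Sum>a\<in>insert a0 A. 2 ^ cyc_count (insert a0 A \<union> C) c a)"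
    using insert a0 by (intro sum_mono cyc_count_insert_max_gain) auto
  also have "\<dots> = (\<Sum>a\<in>insert a0 A. \<Sum>c\<in>C. 2 ^ cyc_count (insert a0 A \<union> C) c a)"
    by (rule sum.swap)
  finally show ?case .
qed auto

section \<open>Values of rotations\<close>

text \<open>The exponent with which a one at position \<open>c\<close> contributes to the rotation
  starting at position \<open>a\<close> of a word of length \<open>q\<close>.\<close>

definition rot_exp :: "nat \<Rightarrow> nat \<Rightarrow> nat \<Rightarrow> nat" where
  "rot_exp q c a = (if c < a then a - c - 1 else q + a - c - 1)"

definition rot_val :: "nat \<Rightarrow> nat set \<Rightarrow> nat \<Rightarrow> nat" where
  "rot_val q C a = (\<Sum>c\<in>C. 2 ^ rot_exp q c a)"

text \<open>\<open>rot_exp\<close> counts all positions of the open arc, \<open>cyc_count\<close>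
  only those in \<open>M\<close>.\<close>

lemma cyc_count_le_rot_exp:
  assumes "M \<subseteq> {..<q}" "a < q" "c < q" "a \<noteq> c"
  shows "cyc_count M c a \<le> rot_exp q c a"
proof (cases "c < a")
  case True
  have "cyc_count M c a \<le> card {c<..<a}"
    unfolding cyc_count_def cyc_between_def using True by (intro card_mono) auto
  then show ?thesis using True by (simp add: rot_exp_def)
next
  case False
  have "cyc_count M c a \<le> card ({..<a} \<union> {c<..<q})"
    unfolding cyc_count_def cyc_between_def using False assms by (intro card_mono) auto
  also have "\<dots> = card {..<a} + card {c<..<q}"
    using False by (intro card_Un_disjoint) auto
  finally show ?thesis using False assms by (simp add: rot_exp_def)
qed

lemma sum_rot_val_ge:
  assumes "A \<subseteq> {..<q}" "C \<subseteq> {..<q}" "A \<inter> C = {}"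
  shows "(2 ^ card A - 1) * (2 ^ card C - 1) \<le> (\<Sum>a\<in>A. rot_val q C a)"
proof -
  have "finite A" "finite C" using assms finite_subset by blast+
  then have "(2 ^ card A - 1) * (2 ^ card C - 1)
      \<le> (\<Sum>a\<in>A. \<Sum>c\<in>C. 2 ^ cyc_count (A \<union> C) c a :: nat)"
    using assms(3) by (rule sum_power2_cyc_count_ge)
  also have "\<dots> \<le> (\<Sum>a\<in>A. rot_val q C a)"
    unfolding rot_val_def using assms
    by (intro sum_mono power_increasing cyc_count_le_rot_exp) auto
  finally show ?thesis .
qed

text \<open>Substitution c = (a + i) mod q in the binary value of a rotation. The weight
  \<open>g\<close> stays general: it is used as the indicator of the ones and as the constant
  1.\<close>

lemma sum_rotate_reindex:
  fixes g :: "nat \<Rightarrow> nat"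
  assumes "a < q"
  shows "(\<Sum>i<q. g ((a + i) mod q) * 2 ^ (q - Suc i)) = (\<Sum>c<q. g c * 2 ^ rot_exp q c a)"
proof (rule sum.reindex_bij_witness[where i = "\<lambda>c. if c < a then q + c - a else c - a"
      and j = "\<lambda>i. (a + i) mod q"])
  fix i assume i: "i \<in> {..<q}"
  have m: "(a + i) mod q = (if a + i < q then a + i else a + i - q)"
    using assms i by (simp add: mod_if)
  show "(if (a + i) mod q < a then q + (a + i) mod q - a else (a + i) mod q - a) = i"
    using assms i unfolding m by auto
  have "rot_exp q ((a + i) mod q) a = q - Suc i"
    using assms i unfolding m rot_exp_def by auto
  then show "g ((a + i) mod q) * 2 ^ rot_exp q ((a + i) mod q) a = g ((a + i) mod q) * 2 ^ (q - Suc i)"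
    by simp
next
  fix c assume c: "c \<in> {..<q}"
  show "(a + (if c < a then q + c - a else c - a)) mod q = c"
    using assms c by auto
qed (use assms in auto)

lemma sum_power2_reverse: "(\<Sum>i<q. 2 ^ (q - Suc i)) = (2 ^ q - 1 :: nat)"
  using sum.nat_diff_reindex[of "\<lambda>i. 2 ^ i :: nat" q] by (simp add: mask_eq_sum_exp_nat lessThan_def)

lemma rot_val_full: "a < q \<Longrightarrow> rot_val q {..<q} a = 2 ^ q - 1"
  using sum_rotate_reindex[of a q "\<lambda>_. 1"] by (simp add: rot_val_def sum_power2_reverse)

lemma rot_val_compl:
  assumes "C \<subseteq> {..<q}" "a < q"
  shows "rot_val q C a + rot_val q ({..<q} - C) a = 2 ^ q - 1"
  using sum.subset_diff[OF assms(1), of "\<lambda>c. 2 ^ rot_exp q c a :: nat"] rot_val_full[OF assms(2)]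
  by (simp add: rot_val_def)

lemma sum_rot_val_total:
  assumes "C \<subseteq> {..<q}"
  shows "(\<Sum>a<q. rot_val q C a) = card C * (2 ^ q - 1)"
proof -
  have "(\<Sum>a<q. 2 ^ rot_exp q c a) = (2 ^ q - 1 :: nat)" if "c < q" for c
  proof -
    \<comment> \<open>Reflecting the positions reverses the arc and exchanges the roles of one and
      start, so the sum over starts becomes the value of the all-ones word.\<close>
    have "(\<Sum>a<q. 2 ^ rot_exp q c a) = (\<Sum>a<q. 2 ^ rot_exp q a (q - Suc c) :: nat)"
      by (rule sum.reindex_bij_witness[where i = "\<lambda>a. q - Suc a" and j = "\<lambda>a. q - Suc a"])
        (use that in \<open>auto simp: rot_exp_def\<close>)
    then show ?thesis using rot_val_full[of "q - Suc c" q] that by (simp add: rot_val_def)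
  qed
  then have "(\<Sum>c\<in>C. \<Sum>a<q. 2 ^ rot_exp q c a) = (\<Sum>c\<in>C. 2 ^ q - 1 :: nat)"
    using assms by (intro sum.cong) auto
  then show ?thesis unfolding rot_val_def by (subst sum.swap) simp
qed

text \<open>The comparison reads off the leading bit of the rotation. If that bit is 0, the
  complementary word has it equal to 1, and the two values add up to
  \<open>2 ^ q - 1\<close>.\<close>

lemma rot_val_head:
  assumes "C \<subseteq> {..<q}" "a < q"
  shows "2 ^ (q - 1) \<le> rot_val q C a \<longleftrightarrow> a \<in> C"
proof -
  have ge: "2 ^ (q - 1) \<le> rot_val q D a" if "a \<in> D" "D \<subseteq> {..<q}" for D
  proof -
    have "2 ^ rot_exp q a a \<le> rot_val q D a"
      unfolding rot_val_def using that finite_subset[OF that(2)] by (intro member_le_sum) auto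
    then show ?thesis by (simp add: rot_exp_def)
  qed
  have "(2::nat) ^ q = 2 * 2 ^ (q - 1)" using assms(2) by (cases q) auto
  have "rot_val q C a < 2 ^ (q - 1)" if "a \<notin> C"
  proof -
    have "2 ^ (q - 1) \<le> rot_val q ({..<q} - C) a" using ge that assms(2) by auto
    moreover have "0 < (2::nat) ^ (q - 1)" by simp
    ultimately show ?thesis
      using rot_val_compl[OF assms] \<open>2 ^ q = 2 * 2 ^ (q - 1)\<close> by linarith
  qed
  then show ?thesis using ge[OF _ assms(1)] by (meson not_le)
qed

lemma bin_val_rotate:
  assumes "a < length w"
  shows "bin_val (rotate a w) = rot_val (length w) {c. c < length w \<and> w ! c} a"
proof -
  have "bin_val (rotate a w) =
      (\<Sum>i<length w. of_bool (w ! ((a + i) mod length w)) * 2 ^ (length w - Suc i))"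
    unfolding bin_val_def by (intro sum.cong) (auto simp: nth_rotate)
  also have "\<dots> = (\<Sum>c<length w. of_bool (w ! c) * 2 ^ rot_exp (length w) c a)"
    using assms by (rule sum_rotate_reindex)
  also have "\<dots> = rot_val (length w) {c. c < length w \<and> w ! c} a"
    unfolding rot_val_def by (intro sum.mono_neutral_cong_right) auto
  finally show ?thesis .
qed

section \<open>Binary value and lexicographic order\<close>

lemma bin_val_Cons: "bin_val (b # x) = (if b then 2 ^ length x else 0) + bin_val x"
  unfolding bin_val_def by (simp add: sum.lessThan_Suc_shift del: sum.lessThan_Suc cong: if_cong)

lemma bin_val_less: "bin_val x < 2 ^ length x"
  by (induction x) (auto simp: bin_val_Cons bin_val_def[of "[]"])

lemma bin_val_mono: "length x = length y \<Longrightarrow> x \<le> y \<Longrightarrow> bin_val x \<le> bin_val y"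
proof (induction x y rule: list_induct2)
  case (Cons a x b y)
  then show ?case
    using bin_val_less[of x] by (auto simp: bin_val_Cons)
qed simp

section \<open>Partial sums and products in sorted order\<close>

text \<open>Exchange argument: the two sets differ by equally many elements, and the last value
  taken, \<open>?t\<close>, separates those lost from those gained.\<close>

lemma sum_take_sorted_le:
  fixes f :: "'a \<Rightarrow> nat"
  assumes s: "distinct s" "sorted (map f s)" and T: "T \<subseteq> set s"
  shows "sum f (set (take (card T) s)) \<le> sum f T"
proof (cases "T = {}")
  case False
  let ?i = "card T" and ?A = "set (take (card T) s)"
  have fin: "finite T" "finite ?A" using T finite_subset by auto
  have ilen: "?i \<le> length s" using s T by (metis card_mono distinct_card finite_set)
  have cA: "card ?A = ?i" using s ilen by (simp add: distinct_card)
  have i0: "0 < ?i" using False fin by auto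
  let ?t = "f (s ! (?i - 1))"
  have le: "f a \<le> ?t" if a: "a \<in> ?A" for a
  proof -
    obtain j where "j < ?i" "a = s ! j"
      using a ilen by (auto simp: in_set_conv_nth)
    then show ?thesis using sorted_nth_mono[OF s(2), of j "?i - 1"] ilen by auto
  qed
  have ge: "?t \<le> f a" if a: "a \<in> T - ?A" for a
  proof -
    obtain j where j: "j < length s" "a = s ! j" using a T by (metis DiffD1 in_set_conv_nth subsetD)
    have "\<not> j < ?i" using j a by (auto simp: in_set_conv_nth)
    then show ?thesis using sorted_nth_mono[OF s(2), of "?i - 1" j] j by auto
  qed
  have "card (?A - T) = card (T - ?A)"
    using cA fin by (metis card_le_sym_Diff dual_order.refl le_antisym)
  then have "sum f (?A - T) \<le> sum f (T - ?A)"
    using sum_bounded_above[of "?A - T" f ?t] sum_bounded_below[of "T - ?A" ?t f] le ge by auto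
  then show ?thesis
    using sum.Int_Diff[OF fin(2), of f T] sum.Int_Diff[OF fin(1), of f ?A]
    by (simp add: Int_commute)
qed simp

text \<open>Since \<open>ln y - ln x \<ge> (y - x) / y\<close> with decreasing weights \<open>1 / y k\<close>, the difference of
  the logarithms is controlled by summation by parts.\<close>

lemma prod_le_of_partial_sums_le:
  fixes x y :: "nat \<Rightarrow> real"
  assumes pos: "\<And>k. k < n \<Longrightarrow> 0 < x k" "\<And>k. k < n \<Longrightarrow> 0 < y k"
    and mono: "\<And>k. Suc k < n \<Longrightarrow> y k \<le> y (Suc k)"
    and sums: "\<And>m. m \<le> n \<Longrightarrow> sum x {..<m} \<le> sum y {..<m}"
  shows "prod x {..<n} \<le> prod y {..<n}"
proof -
  have parts: "(\<Sum>j<m. y j - x j) / y k \<le> (\<Sum>j<m. (y j - x j) / y j)" if "m = Suc k" "m \<le> n" for m k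
    using that
  proof (induction k arbitrary: m)
    case (Suc k)
    \<comment> \<open>The partial sum is nonnegative, so enlarging the denominator can only decrease
      the quotient.\<close>
    have "(\<Sum>j<Suc k. y j - x j) / y (Suc k) \<le> (\<Sum>j<Suc k. y j - x j) / y k"
      using Suc.prems pos mono[of k] sums[of "Suc k"]
      by (intro divide_left_mono) (auto simp: sum_subtractf)
    also have "\<dots> \<le> (\<Sum>j<Suc k. (y j - x j) / y j)" using Suc by simp
    finally show ?case unfolding Suc.prems(1) sum.lessThan_Suc[of _ "Suc k"] add_divide_distrib
      by simp
  qed simp
  have "0 \<le> (\<Sum>j<n. (y j - x j) / y j)"
  proof (cases n)
    case (Suc k)
    have "0 \<le> (\<Sum>j<n. y j - x j) / y k"
      using pos(2)[of k] sums[of n] Suc by (simp add: sum_subtractf)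
    also have "\<dots> \<le> (\<Sum>j<n. (y j - x j) / y j)" using parts Suc by blast
    finally show ?thesis .
  qed simp
  also have "\<dots> \<le> (\<Sum>j<n. ln (y j) - ln (x j))"
  proof (rule sum_mono)
    fix j assume "j \<in> {..<n}"
    then have p: "0 < x j" "0 < y j" using pos by auto
    have "ln (x j / y j) \<le> x j / y j - 1" using p by (intro ln_le_minus_one) auto
    then show "(y j - x j) / y j \<le> ln (y j) - ln (x j)"
      using p by (simp add: ln_div diff_divide_distrib)
  qed
  also have "\<dots> = ln (prod y {..<n}) - ln (prod x {..<n})"
    using ln_prod[of "{..<n}" x] ln_prod[of "{..<n}" y] pos
    by (simp add: sum_subtractf less_imp_neq[THEN not_sym])
  finally have "ln (prod x {..<n}) \<le> ln (prod y {..<n})" by simp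
  moreover have "0 < prod x {..<n}" "0 < prod y {..<n}"
    using pos by (auto intro: prod_pos)
  ultimately show ?thesis by simp
qed

lemma set_take_reindex:
  assumes "distinct s" "m \<le> length s"
  shows "sum f (set (take m s)) = (\<Sum>j<m. f (s ! j))"
proof -
  have "set (take m s) = (!) s ` {..<m}"
    using nth_image[OF assms(2)] by (simp add: lessThan_atLeast0)
  moreover have "inj_on ((!) s) {..<m}" using assms by (auto intro: inj_on_nth)
  ultimately show ?thesis by (simp add: sum.reindex)
qed

text \<open>Starting positions are sorted instead of words. Positions stay distinct even when
  rotations coincide, so sums over the smallest values become sums over sets of positions.\<close>

lemma orbit_order:
  obtains s where "distinct s" "set s = {..<length w}"
    "sorted (map (rot_val (length w) {c. c < length w \<and> w ! c}) s)"
    "\<And>k. k < length w \<Longrightarrow> I_val w (Suc k) = rot_val (length w) {c. c < length w \<and> w ! c} (s ! k)"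
proof -
  let ?V = "rot_val (length w) {c. c < length w \<and> w ! c}"
  define s where "s = sort_key (\<lambda>k. rotate k w) [0..<length w]"
  have s: "distinct s" "set s = {..<length w}" "length s = length w"
    by (auto simp: s_def)
  have sorted: "sorted (map (\<lambda>k. rotate k w) s)" by (simp add: s_def)
  then have os: "orbit_sorted w = map (\<lambda>k. rotate k w) s"
    unfolding orbit_sorted_def by (intro properties_for_sort) (simp_all add: s_def)
  have V: "?V (s ! k) = bin_val (rotate (s ! k) w)" if "k < length w" for k
    using that s nth_mem[of k s] by (simp add: bin_val_rotate)
  have "sorted (map ?V s)"
    using sorted s unfolding sorted_iff_nth_mono by (auto simp: V intro!: bin_val_mono)
  moreover have "I_val w (Suc k) = ?V (s ! k)" if "k < length w" for k
    using that s by (simp add: I_val_def os V)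
  ultimately show thesis using that s by blast
qed

section \<open>Lower bounds for the partial sums of an arbitrary word\<close>

locale sorted_rotations =
  fixes q :: nat and C :: "nat set" and s :: "nat list"
  assumes C: "C \<subseteq> {..<q}"
    and s: "distinct s" "set s = {..<q}" "sorted (map (rot_val q C) s)"
begin

lemma length_s: "length s = q"
  using s distinct_card by fastforce

lemma finite_C: "finite C" and card_C: "card C \<le> q"
  using C finite_subset card_mono[OF _ C] by auto

lemma card_zeros: "card ({..<q} - C) = q - card C"
  using C finite_C by (simp add: card_Diff_subset)

lemma take_drop:
  shows "set (take i s) \<union> set (drop i s) = {..<q}" "set (take i s) \<inter> set (drop i s) = {}"
  using s set_append[of "take i s" "drop i s"] set_take_disj_set_drop_if_distinct[of s i i] by auto

lemma take_le_drop:
  assumes "x \<in> set (take i s)" "y \<in> set (drop i s)"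
  shows "rot_val q C x \<le> rot_val q C y"
proof -
  have "sorted (map (rot_val q C) (take i s @ drop i s))" using s by simp
  then show ?thesis using assms unfolding map_append sorted_append by auto
qed

text \<open>Rotations starting with 0 have smaller values than those starting with 1, so they fill
  the first \<open>q - card C\<close> places.\<close>

lemma take_zeros:
  assumes "i \<le> q - card C"
  shows "set (take i s) \<inter> C = {}"
proof (rule ccontr)
  assume "\<not> ?thesis"
  then obtain a where a: "a \<in> set (take i s)" "a \<in> C" by auto
  have "y \<in> C" if y: "y \<in> set (drop i s)" for y
  proof -
    have "y < q" "a < q" using y a take_drop[of i] by auto
    then show ?thesis using take_le_drop[OF a(1) y] rot_val_head[OF C, of a] rot_val_head[OF C, of y] a
      by auto
  qed
  then have "{..<q} - C \<subset> set (take i s)" using take_drop[of i] a by blast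
  then have "q - card C < card (set (take i s))"
    using psubset_card_mono[of "set (take i s)" "{..<q} - C"] card_zeros by simp
  also have "\<dots> \<le> i" using card_length[of "take i s"] by simp
  finally show False using assms by simp
qed

lemma drop_ones:
  assumes "q - card C \<le> i" "i \<le> q"
  shows "set (drop i s) \<subseteq> C"
proof (rule ccontr)
  assume "\<not> ?thesis"
  then obtain b where b: "b \<in> set (drop i s)" "b \<notin> C" by auto
  have "x \<notin> C" if x: "x \<in> set (take i s)" for x
  proof -
    have "x < q" "b < q" using x b take_drop[of i] by auto
    then show ?thesis using take_le_drop[OF x b(1)] rot_val_head[OF C, of x] rot_val_head[OF C, of b] b
      by auto
  qed
  then have "set (take i s) \<subset> {..<q} - C" using take_drop[of i] b by blast
  then have "card (set (take i s)) < q - card C"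
    using psubset_card_mono[of "{..<q} - C" "set (take i s)"] card_zeros by simp
  moreover have "card (set (take i s)) = i" using s assms length_s by (simp add: distinct_card)
  ultimately show False using assms by simp
qed

lemma sum_take_ge_low:
  assumes "i \<le> q - card C"
  shows "(2 ^ i - 1) * (2 ^ card C - 1) \<le> sum (rot_val q C) (set (take i s))"
proof -
  have "card (set (take i s)) = i" using s assms length_s by (simp add: distinct_card)
  then show ?thesis
    using sum_rot_val_ge[OF _ C take_zeros[OF assms]] take_drop[of i] by auto
qed

text \<open>The last \<open>n\<close> starts are ones. Complementing the word makes them zeros, so
  \<open>sum_rot_val_ge\<close> bounds their complementary values from below and their own values
  from above; the total over all starts is fixed. Both sides are kept additive to avoid truncated
  subtraction.\<close>

lemma sum_take_ge_high:
  assumes "n \<le> card C"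
  shows "card C * (2 ^ q - 1) + (2 ^ n - 1) * (2 ^ (q - card C) - 1)
    \<le> sum (rot_val q C) (set (take (q - n) s)) + n * (2 ^ q - 1)"
proof -
  let ?A = "set (take (q - n) s)" and ?B = "set (drop (q - n) s)"
  have n: "n \<le> q" using assms card_C by simp
  have cB: "card ?B = n" using s n length_s by (simp add: distinct_card)
  have B: "?B \<subseteq> C" using assms by (intro drop_ones) auto
  have "sum (rot_val q C) ?A + sum (rot_val q C) ?B = card C * (2 ^ q - 1)"
    using sum.union_disjoint[of ?A ?B "rot_val q C"] take_drop[of "q - n"] sum_rot_val_total[OF C]
    by simp
  moreover have "sum (rot_val q C) ?B + sum (rot_val q ({..<q} - C)) ?B = n * (2 ^ q - 1)"
  proof -
    have "sum (rot_val q C) ?B + sum (rot_val q ({..<q} - C)) ?B = (\<Sum>b\<in>?B. 2 ^ q - 1)"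
      unfolding sum.distrib[symmetric] using B C by (intro sum.cong rot_val_compl) auto
    then show ?thesis using cB by simp
  qed
  moreover have "(2 ^ n - 1) * (2 ^ (q - card C) - 1) \<le> sum (rot_val q ({..<q} - C)) ?B"
    using sum_rot_val_ge[of ?B q "{..<q} - C"] B C cB card_zeros by auto
  ultimately show ?thesis by linarith
qed

end

section \<open>Matching upper bounds for the block word\<close>

lemma sum_power2_lessThan: "(\<Sum>i<n. 2 ^ i) = (2 ^ n - 1 :: nat)"
  by (simp add: mask_eq_sum_exp_nat lessThan_def)

locale sorted_block_rotations = sorted_rotations q "{q - p..<q}" s for q p s +
  assumes p: "p \<le> q"
begin

lemma sum_take_le_low:
  assumes "i \<le> q - p"
  shows "sum (rot_val q {q - p..<q}) (set (take i s)) \<le> (2 ^ i - 1) * (2 ^ p - 1)"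
proof -
  \<comment> \<open>A start inside the zero block gives the rotation
    \<open>0^(q-p-a) 1^p 0^a\<close>.\<close>
  have val: "rot_val q {q - p..<q} a = 2 ^ a * (2 ^ p - 1)" if "a < i" for a
  proof -
    have "rot_val q {q - p..<q} a = (\<Sum>j<p. 2 ^ (a + j))"
      unfolding rot_val_def
      by (rule sum.reindex_bij_witness[where i = "\<lambda>j. q - Suc j" and j = "\<lambda>c. q - Suc c"])
        (use that assms p in \<open>auto simp: rot_exp_def\<close>)
    then show ?thesis by (simp add: power_add sum_power2_lessThan flip: sum_distrib_left)
  qed
  have "sum (rot_val q {q - p..<q}) (set (take (card {..<i}) s)) \<le> sum (rot_val q {q - p..<q}) {..<i}"
    using s assms by (intro sum_take_sorted_le) auto
  also have "\<dots> = (\<Sum>a<i. 2 ^ a * (2 ^ p - 1))" using val by simp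
  also have "\<dots> = (2 ^ i - 1) * (2 ^ p - 1)"
    by (simp add: sum_power2_lessThan flip: sum_distrib_right)
  finally show ?thesis by simp
qed

lemma sum_take_le_high:
  assumes "n \<le> p"
  shows "sum (rot_val q {q - p..<q}) (set (take (q - n) s)) + n * (2 ^ q - 1)
    \<le> p * (2 ^ q - 1) + (2 ^ n - 1) * (2 ^ (q - p) - 1)"
proof -
  let ?V = "rot_val q {q - p..<q}" and ?B = "{q - p..<q - p + n}"
  have zeros: "{..<q} - {q - p..<q} = {..<q - p}" by auto
  have B: "?B \<subseteq> {..<q}" using assms p by auto
  \<comment> \<open>In the complementary word the zero block of the original becomes a block of
    \<open>q - p\<close> ones, which the rotation leaves followed by \<open>j\<close> zeros when
    \<open>j < p\<close>.\<close>
  have val: "rot_val q {..<q - p} (q - p + j) = 2 ^ j * (2 ^ (q - p) - 1)" for j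
  proof -
    have "rot_val q {..<q - p} (q - p + j) = (\<Sum>i<q - p. 2 ^ (j + i))"
      unfolding rot_val_def
      by (rule sum.reindex_bij_witness[where i = "\<lambda>i. q - p - Suc i" and j = "\<lambda>c. q - p - Suc c"])
        (auto simp: rot_exp_def)
    then show ?thesis by (simp add: power_add sum_power2_lessThan flip: sum_distrib_left)
  qed
  have "sum (rot_val q {..<q - p}) ?B = (\<Sum>j<n. rot_val q {..<q - p} (q - p + j))"
    by (rule sum.reindex_bij_witness[where i = "\<lambda>j. q - p + j" and j = "\<lambda>b. b - (q - p)"]) auto
  also have "\<dots> = (2 ^ n - 1) * (2 ^ (q - p) - 1)"
    unfolding val by (simp add: sum_power2_lessThan flip: sum_distrib_right)
  finally have W: "sum (rot_val q {..<q - p}) ?B = (2 ^ n - 1) * (2 ^ (q - p) - 1)" .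
  have "sum ?V ?B + sum (rot_val q {..<q - p}) ?B = (\<Sum>b\<in>?B. 2 ^ q - 1)"
    unfolding sum.distrib[symmetric] zeros[symmetric] using B C
    by (intro sum.cong rot_val_compl) auto
  then have VW: "sum ?V ?B + sum (rot_val q {..<q - p}) ?B = n * (2 ^ q - 1)" by simp
  have cT: "card ({..<q} - ?B) = q - n" using B by (simp add: card_Diff_subset)
  \<comment> \<open>The test set omits the first \<open>n\<close> starts in the block of ones; its
    sum is the total minus the values computed through the complement.\<close>
  have "sum ?V (set (take (card ({..<q} - ?B)) s)) \<le> sum ?V ({..<q} - ?B)"
    using s by (intro sum_take_sorted_le) auto
  moreover have "sum ?V ({..<q} - ?B) + sum ?V ?B = p * (2 ^ q - 1)"
    using sum.subset_diff[OF B, of ?V] sum_rot_val_total[OF C] p by simp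
  ultimately show ?thesis using W VW unfolding cT by linarith
qed

end

section \<open>Comparison of partial sums and passage to products\<close>

lemma sum_take_block_le:
  assumes "sorted_block_rotations q p s" "sorted_rotations q C t" "card C = p" "m \<le> q"
  shows "sum (rot_val q {q - p..<q}) (set (take m s)) \<le> sum (rot_val q C) (set (take m t))"
proof -
  interpret u: sorted_block_rotations q p s by fact
  interpret w: sorted_rotations q C t by fact
  show ?thesis
  proof (cases "m \<le> q - p")
    case True
    then show ?thesis using u.sum_take_le_low[of m] w.sum_take_ge_low[of m] assms by simp
  next
    case False
    then have "q - m \<le> p" "q - (q - m) = m" using assms by auto
    then show ?thesis using u.sum_take_le_high[of "q - m"] w.sum_take_ge_high[of "q - m"] assms by simp
  qed
qed

theorem theorem6:
  fixes p q :: nat and w :: "bool list"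
  assumes "1 \<le> p" and "p < q - p"
    and "length w = q" and "ones w = p"
  shows "\<forall>i. 1 \<le> i \<and> i \<le> q \<longrightarrow>
           P_val (replicate (q - p) False @ replicate p True) i \<le> P_val w i"
proof (intro allI impI)
  fix i assume "1 \<le> i \<and> i \<le> q"
  then have i: "i \<le> q" by simp
  define u where "u = replicate (q - p) False @ replicate p True"
  define C where "C = {c. c < q \<and> w ! c}"
  define U where "U = {q - p..<q}"
  have p: "p \<le> q" using assms by simp
  have len: "length u = q" using p by (simp add: u_def)
  have U: "{c. c < q \<and> u ! c} = U" using p by (auto simp: u_def U_def nth_append)
  have cC: "card C = p"
    using assms length_filter_conv_card[of id w] by (simp add: C_def ones_def)
  have cU: "card U = p" using p by (simp add: U_def)
  have CU: "C \<subseteq> {..<q}" "U \<subseteq> {..<q}" by (auto simp: C_def U_def)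
  obtain s where s: "distinct s" "set s = {..<q}" "sorted (map (rot_val q U) s)"
    "\<And>k. k < q \<Longrightarrow> I_val u (Suc k) = rot_val q U (s ! k)"
    using orbit_order[of u] unfolding len U by metis
  obtain t where t: "distinct t" "set t = {..<q}" "sorted (map (rot_val q C) t)"
    "\<And>k. k < q \<Longrightarrow> I_val w (Suc k) = rot_val q C (t ! k)"
    using orbit_order[of w] unfolding assms(3) C_def[symmetric] by metis
  have su: "sorted_block_rotations q p s" using s CU p by unfold_locales (simp_all add: U_def)
  have st: "sorted_rotations q C t" using t CU by unfold_locales
  have length: "length s = q" "length t = q"
    using s t distinct_card[of s] distinct_card[of t] by auto
  have pos: "0 < rot_val q D a" if "card D = p" for D a
    using that assms(1) card_gt_0_iff[of D] unfolding rot_val_def by (intro sum_pos) auto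
  \<comment> \<open>The comparison of products uses logarithms, hence the cast to the reals;
    positivity comes from there being at least one 1.\<close>
  have "(\<Prod>k<i. real (rot_val q U (s ! k))) \<le> (\<Prod>k<i. real (rot_val q C (t ! k)))"
  proof (rule prod_le_of_partial_sums_le)
    show "real (rot_val q C (t ! k)) \<le> real (rot_val q C (t ! Suc k))" if "Suc k < i" for k
      using sorted_nth_mono[OF t(3), of k "Suc k"] that i length by simp
    show "(\<Sum>k<m. real (rot_val q U (s ! k))) \<le> (\<Sum>k<m. real (rot_val q C (t ! k)))" if "m \<le> i" for m
      using sum_take_block_le[OF su st cC, of m] that i length s(1) t(1)
      by (simp add: set_take_reindex U_def flip: of_nat_sum)
  qed (use pos cC cU in auto)
  then have "(\<Prod>k<i. rot_val q U (s ! k)) \<le> (\<Prod>k<i. rot_val q C (t ! k))"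
    by (simp flip: of_nat_prod)
  then show "P_val (replicate (q - p) False @ replicate p True) i \<le> P_val w i"
    using s(4) t(4) i unfolding P_val_def u_def[symmetric] by (simp add: prod.atLeast1_atMost_eq)
qed

end
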